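(* For all $n\ge 2$ and all nonnegative integers $x_2,\dots,x_n$, the quantity $A(x_2,\dots,x_n)$ is well-defined, i.e. there is a nonnegative integer $x_1$ such that $\mathcal{N}(a,x_2,\dots,x_n)=a+x_2+\cdots+x_n$ for all $a\ge x_1$. Furthermore, $A(x_2,\dots,x_n)$ is bounded above quadratically in the sum $x_2+\cdots+x_n$: there is an absolute constant $C$ such that $A(x_2,\dots,x_n)\le C\,(x_2+\cdots+x_n)^2$ for all $n\ge 2$ and all nonnegative integers $x_2,\dots,x_n$.
   Context: For nonnegative integers $x_1,\dots,x_n$ ($n\ge 2$), the Auxiliary Nim position $(x_1,x_2,\dots,x_n)$, i.e. the selective compound of the Nim heap $*x_1$ with the disjunctive sum of the Nim heaps $*x_2,\dots,*x_n$, is the impartial game (normal play) in which a move consists of one of the following: strictly decrease $x_1$ only; strictly decrease exactly one of $x_2,\dots,x_n$ only; or do both simultaneously (strictly decrease $x_1$ and strictly decrease exactly one of $x_2,\dots,x_n$). All heap sizes stay nonnegative integers. $\mathcal{N}(x_1,\dots,x_n)$ denotes the Sprague-Grundy value: $0$ at terminal positions, and otherwise the minimum nonnegative integer not occurring among the Sprague-Grundy values of the positions reachable in one move. $A(x_2,\dots,x_n)$ is defined as the least nonnegative integer $x_1$ such that for all integers $a\ge x_1$, $\mathcal{N}(a,x_2,\dots,x_n)=a+x_2+\cdots+x_n$. *)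

theory Defs
  imports Complex_Main
begin

definition mex :: "nat set \<Rightarrow> nat" where
  "mex S = (LEAST m. m \<notin> S)"

text \<open>A pair \<open>(x, ys)\<close> stands for the Auxiliary Nim position \<open>(x\<^sub>1, \<dots>, x\<^sub>n)\<close> with
  \<open>x = x\<^sub>1\<close> and \<open>ys = [x\<^sub>2, \<dots>, x\<^sub>n]\<close>, so that \<open>n = length ys + 1\<close>.\<close>

type_synonym position = "nat \<times> nat list"

inductive aux_move :: "position \<Rightarrow> position \<Rightarrow> bool" where
  first: "x' < x \<Longrightarrow> aux_move (x, ys) (x', ys)"
| other: "i < length ys \<Longrightarrow> y < ys ! i \<Longrightarrow> aux_move (x, ys) (x, ys[i := y])"
| both: "x' < x \<Longrightarrow> i < length ys \<Longrightarrow> y < ys ! i \<Longrightarrow> aux_move (x, ys) (x', ys[i := y])"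

lemma sum_list_update_less:
  fixes ys :: "nat list"
  assumes "i < length ys" "y < ys ! i"
  shows "sum_list (ys[i := y]) < sum_list ys"
  using assms
proof (induction ys arbitrary: i)
  case (Cons z zs)
  then show ?case by (cases i) auto
qed simp

lemma aux_move_decreases:
  "aux_move p q \<Longrightarrow> fst q + sum_list (snd q) < fst p + sum_list (snd p)"
  by (induction rule: aux_move.induct) (auto dest: sum_list_update_less intro: add_less_mono)

function grundy :: "position \<Rightarrow> nat" where
  "grundy p = mex (grundy ` {q. aux_move p q})"
  by auto
termination
  by (relation "measure (\<lambda>p. fst p + sum_list (snd p))") (auto dest: aux_move_decreases)

declare grundy.simps [simp del]

definition aux_threshold :: "nat list \<Rightarrow> nat" where
  "aux_threshold ys = (LEAST x. \<forall>a\<ge>x. grundy (a, ys) = a + sum_list ys)"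

end

theory Submission
  imports Defs
begin

text \<open>
  Write \<open>S\<close> for the sum of the heaps \<open>ys\<close>.  The value \<open>a + S\<close> is an upper bound for the
  Grundy value of \<open>(a, ys)\<close>, because it bounds the length of any play.  The key observation is
  that every move from \<open>(b, ys)\<close> that touches \<open>ys\<close> has a counterpart with the same result from
  \<open>(a, ys)\<close> whenever \<open>b < a\<close>, since in the selective compound the first heap may be lowered along
  with another one.  Hence the options only grow with the first heap, the Grundy value is
  strictly increasing in it (lemma \<open>strict_mono_grundy_first\<close>), and so it is at least \<open>a\<close>.

  The rest is an induction on \<open>S\<close>.  Removing a single token from \<open>ys\<close> gives heaps \<open>zs\<close> of sum
  \<open>S - 1\<close>, and from some threshold \<open>t\<close> on the values of \<open>(b, zs)\<close> are \<open>b + S - 1\<close>.  All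
  positions \<open>(b, zs)\<close> with \<open>t \<le> b \<le> a\<close> are options of \<open>(a, ys)\<close>, so the values from
  \<open>t + S - 1\<close> to \<open>a + S - 1\<close> are excluded for \<open>(a, ys)\<close>.  If \<open>a \<ge> t + S - 1\<close>, then the lower
  bound \<open>a\<close> and the upper bound \<open>a + S\<close> leave only the value \<open>a + S\<close>.  The threshold thus grows
  by at most \<open>S - 1\<close> when the sum grows from \<open>S - 1\<close> to \<open>S\<close>, and adding up these increments
  gives the bound \<open>0 + 1 + \<dots> + (S - 1) \<le> S\<^sup>2\<close>.
\<close>

lemma mex_le: "m \<notin> X \<Longrightarrow> mex X \<le> m"
  unfolding mex_def by (rule Least_le)

lemma mex_notin: "m \<notin> X \<Longrightarrow> mex X \<notin> X"
  unfolding mex_def by (rule LeastI)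

lemma mex_mono:
  assumes "X \<subseteq> Y" "m \<notin> Y"
  shows "mex X \<le> mex Y"
  using assms mex_notin[of m Y] by (intro mex_le) auto

lemma total_notin_option_values:
  assumes "\<And>q. aux_move p q \<Longrightarrow> grundy q \<le> fst q + sum_list (snd q)"
  shows "fst p + sum_list (snd p) \<notin> grundy ` {q. aux_move p q}"
  using assms aux_move_decreases[of p] by fastforce

lemma grundy_le_total: "grundy p \<le> fst p + sum_list (snd p)"
proof (induction p rule: grundy.induct)
  case (1 p)
  then show ?case
    unfolding grundy.simps[of p] by (intro mex_le total_notin_option_values) auto
qed

lemma grundy_move_neq:
  assumes "aux_move p q"
  shows "grundy q \<noteq> grundy p"
proof -
  have "grundy p \<notin> grundy ` {q. aux_move p q}"
    unfolding grundy.simps[of p]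
    by (rule mex_notin[OF total_notin_option_values]) (rule grundy_le_total)
  then show ?thesis using assms by (metis imageI mem_Collect_eq)
qed

text \<open>The first heap can be lowered for free together with any other move, so a smaller first
  heap offers no option that a larger one lacks.\<close>

lemma aux_move_first_mono:
  assumes "aux_move (b, ys) q" "b \<le> a"
  shows "aux_move (a, ys) q"
  using assms(1)
proof cases
  case (first x')
  then show ?thesis using assms(2) by (auto intro: aux_move.first)
next
  case (other i y)
  then show ?thesis using assms(2)
    by (cases "b = a") (auto intro: aux_move.other aux_move.both)
next
  case (both x' i y)
  then show ?thesis using assms(2) by (auto intro: aux_move.both)
qed

text \<open>More options can only raise the minimal excludant; the increase is strict because the
  smaller position is itself an option of the larger one.\<close>

lemma strict_mono_grundy_first: "strict_mono (\<lambda>a. grundy (a, ys))"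
proof (rule strict_monoI)
  fix b a :: nat
  assume "b < a"
  have "grundy (b, ys) \<le> grundy (a, ys)"
    unfolding grundy.simps[of "(b, ys)"] grundy.simps[of "(a, ys)"]
  proof (rule mex_mono)
    show "grundy ` {q. aux_move (b, ys) q} \<subseteq> grundy ` {q. aux_move (a, ys) q}"
      using \<open>b < a\<close> by (intro image_mono Collect_mono impI) (rule aux_move_first_mono, auto)
  qed (rule total_notin_option_values, rule grundy_le_total)
  moreover have "grundy (b, ys) \<noteq> grundy (a, ys)"
    using \<open>b < a\<close> by (intro grundy_move_neq aux_move.first)
  ultimately show "grundy (b, ys) < grundy (a, ys)" by simp
qed

lemma first_le_grundy: "a \<le> grundy (a, ys)"
  using strict_mono_imp_increasing[OF strict_mono_grundy_first] .

lemma obtain_remove_token: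
  fixes ys :: "nat list"
  assumes "sum_list ys = Suc s"
  obtains i y where "i < length ys" "y < ys ! i" "sum_list (ys[i := y]) = s"
proof -
  have "\<exists>v\<in>set ys. v \<noteq> 0" using assms sum_list_eq_0_iff[of ys] by auto
  then obtain i where i: "i < length ys" "ys ! i \<noteq> 0" by (auto simp: in_set_conv_nth)
  have "ys ! i \<le> sum_list ys" using i by (intro elem_le_sum_list)
  then have "sum_list (ys[i := ys ! i - 1]) = s"
    using i assms by (simp add: sum_list_update)
  then show ?thesis using i that[of i "ys ! i - 1"] by simp
qed

lemma grundy_eq_total:
  assumes "\<Sum>{..<sum_list ys} \<le> a"
  shows "grundy (a, ys) = a + sum_list ys"
  using assms
proof (induction "sum_list ys" arbitrary: ys a)
  case 0
  then show ?case using first_le_grundy[of a ys] grundy_le_total[of "(a, ys)"] 0(1) by (simp del: sum_list_eq_0_iff)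
next
  case (Suc s)
  obtain i y where iy: "i < length ys" "y < ys ! i" and s: "sum_list (ys[i := y]) = s"
    using Suc.hyps(2) by (metis obtain_remove_token)
  have sum: "\<Sum>{..<s} + s \<le> a" using Suc.prems by (simp flip: Suc.hyps(2))
  have excluded: "grundy (a, ys) \<noteq> b + s" if "\<Sum>{..<s} \<le> b" "b \<le> a" for b
  proof -
    have "aux_move (b, ys) (b, ys[i := y])" using iy by (rule aux_move.other)
    then have "aux_move (a, ys) (b, ys[i := y])" using \<open>b \<le> a\<close> by (rule aux_move_first_mono)
    moreover have "grundy (b, ys[i := y]) = b + s"
      using Suc.hyps(1)[of "ys[i := y]" b] s that(1) by simp
    ultimately show ?thesis using grundy_move_neq by fastforce
  qed
  have lower: "a \<le> grundy (a, ys)" by (rule first_le_grundy)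
  have upper: "grundy (a, ys) \<le> a + Suc s"
    using grundy_le_total[of "(a, ys)"] Suc.hyps(2) by simp
  \<comment> \<open>A value between \<open>a\<close> and \<open>a + s\<close> has the form \<open>b + s\<close> with \<open>b\<close> at least \<open>a - s\<close>,
    which is past the threshold for sum \<open>s\<close>.\<close>
  have "\<not> grundy (a, ys) \<le> a + s"
    using excluded[of "grundy (a, ys) - s"] sum lower by linarith
  then show ?case using upper Suc.hyps(2) by linarith
qed

lemma aux_threshold_le: "aux_threshold ys \<le> \<Sum>{..<sum_list ys}"
  unfolding aux_threshold_def by (rule Least_le) (auto intro: grundy_eq_total)

theorem theorem2:
  shows "(\<forall>n\<ge>2. \<forall>ys :: nat list. length ys + 1 = n \<longrightarrow>
            (\<exists>x. \<forall>a\<ge>x. grundy (a, ys) = a + sum_list ys)) \<and>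
         (\<exists>C::real. \<forall>n\<ge>2. \<forall>ys :: nat list. length ys + 1 = n \<longrightarrow>
            real (aux_threshold ys) \<le> C * (real (sum_list ys))\<^sup>2)"
proof -
  have "real (aux_threshold ys) \<le> 1 * (real (sum_list ys))\<^sup>2" for ys
  proof -
    have "\<Sum>{..<sum_list ys} \<le> (sum_list ys)\<^sup>2"
      using sum_bounded_above[of "{..<sum_list ys}" "\<lambda>k. k" "sum_list ys"]
      by (simp add: power2_eq_square)
    then have "aux_threshold ys \<le> (sum_list ys)\<^sup>2"
      using aux_threshold_le[of ys] by (rule order.trans[rotated])
    then show ?thesis by (simp flip: of_nat_power)
  qed
  then show ?thesis using grundy_eq_total by blast
qed

end
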